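(* Let $J_0=0$, $J_1=1$, $J_{n+2}=J_{n+1}+2J_n$ be the Jacobsthal numbers and suppose the move costs are $w_{n,k}=\alpha_n=J_{n+1}$ for all $n\in\mathbb{N}_0$ and all $k\in T=\{0,1,2\}$. Let $t_n$ denote the common value $d_{n,0}=d_{n,1}=d_{n,2}$ of the minimal costs. Then for all $n\in\mathbb{N}_0$, $$t_n=\tfrac13\left((n+1)2^n-J_{n+1}\right).$$ Moreover, $(t_n)$ satisfies the order-$3$ recurrence $$t_0=0,\ t_1=1,\ t_2=3,\qquad t_{n+3}=3t_{n+2}-4t_n\quad(n\in\mathbb{N}_0).$$
   Context: Weighted Tower of Hanoi: $\mathbb{N}_0$ denotes the nonnegative integers; $T=\{0,1,2\}$ is the set of pegs; discs are labelled $1,2,3,\dots$ by increasing size. A state with $n$ discs is an assignment of the discs $1,\dots,n$ to the pegs, the discs on each peg being stacked with smaller discs above larger ones. A legal move transfers the topmost (smallest) disc of one peg to a different peg carrying no smaller disc. For $i\in T$, $i^n$ is the perfect state with all $n$ discs on peg $i$. For $\{i,j,k\}=T$ and $n\in\mathbb{N}_0$, $w_{n,k}\in[0,\infty)$ is a given cost of a single move of disc $n+1$ between pegs $i$ and $j$ (in either direction), and $d_{n,k}$ is the minimal total cost, over all finite sequences of legal moves, of getting from $i^n$ to $j^n$ with $n$ discs. When the costs do not depend on $k$, the values $d_{n,0},d_{n,1},d_{n,2}$ coincide. *)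

theory Defs
  imports Complex_Main "HOL-Library.FuncSet"
begin

fun jacobsthal :: "nat \<Rightarrow> nat" where
  "jacobsthal 0 = 0"
| "jacobsthal (Suc 0) = 1"
| "jacobsthal (Suc (Suc n)) = jacobsthal (Suc n) + 2 * jacobsthal n"

definition pegs :: "nat set" where
  "pegs = {0, 1, 2}"

text \<open>Since the discs on each peg are ordered by size, a state is determined by the peg of each
  disc. Extensionality (the value outside \<open>{1..n}\<close> is fixed) makes equality of functions the same
  as equality of states.\<close>

definition states :: "nat \<Rightarrow> (nat \<Rightarrow> nat) set" where
  "states n = {1..n} \<rightarrow>\<^sub>E pegs"

definition perfect :: "nat \<Rightarrow> nat \<Rightarrow> (nat \<Rightarrow> nat)" where
  "perfect n i = (\<lambda>m\<in>{1..n}. i)"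

text \<open>In state \<open>s\<close>, disc \<open>m\<close> is topmost on its peg \<open>i\<close>, and the other peg \<open>j\<close> carries no
  smaller disc.\<close>

definition legal_move :: "nat \<Rightarrow> (nat \<Rightarrow> nat) \<Rightarrow> nat \<Rightarrow> nat \<Rightarrow> nat \<Rightarrow> bool" where
  "legal_move n s m i j \<longleftrightarrow>
     m \<in> {1..n} \<and> i \<in> pegs \<and> j \<in> pegs \<and> i \<noteq> j \<and> s m = i \<and>
     (\<forall>l\<in>{1..<m}. s l \<noteq> i \<and> s l \<noteq> j)"

text \<open>\<open>path_cost w n s s' c\<close>: some finite sequence of legal moves with \<open>n\<close> discs leads from \<open>s\<close>
  to \<open>s'\<close> and has total cost \<open>c\<close>. Costs are indexed as \<open>w n k\<close> for a move of disc \<open>n + 1\<close>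
  between the two pegs other than \<open>k\<close>, so moving disc \<open>m\<close> uses \<open>w (m - 1)\<close>.\<close>

inductive path_cost ::
  "(nat \<Rightarrow> nat \<Rightarrow> real) \<Rightarrow> nat \<Rightarrow> (nat \<Rightarrow> nat) \<Rightarrow> (nat \<Rightarrow> nat) \<Rightarrow> real \<Rightarrow> bool"
  for w :: "nat \<Rightarrow> nat \<Rightarrow> real" and n :: nat
where
  stay: "s \<in> states n \<Longrightarrow> path_cost w n s s 0"
| move: "\<lbrakk>s \<in> states n; legal_move n s m i j; {i, j, k} = pegs; path_cost w n (s(m := j)) s' c\<rbrakk>
    \<Longrightarrow> path_cost w n s s' (w (m - 1) k + c)"

definition is_min_cost ::
  "(nat \<Rightarrow> nat \<Rightarrow> real) \<Rightarrow> nat \<Rightarrow> (nat \<Rightarrow> nat) \<Rightarrow> (nat \<Rightarrow> nat) \<Rightarrow> real \<Rightarrow> bool"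
where
  "is_min_cost w n s s' c \<longleftrightarrow>
     path_cost w n s s' c \<and> (\<forall>c'. path_cost w n s s' c' \<longrightarrow> c \<le> c')"

lemma is_min_cost_unique:
  "is_min_cost w n s s' c \<Longrightarrow> is_min_cost w n s s' d \<Longrightarrow> c = d"
  by (meson is_min_cost_def order_antisym)

end

theory Submission
  imports Defs
begin

text \<open>If all moves of a disc cost the same, whatever the two pegs, the minimal cost \<open>t\<close> of
  transferring a tower satisfies \<open>t (n + 1) = 2 * t n + \<alpha> n\<close>, where \<open>\<alpha> n\<close> is the cost of moving
  disc \<open>n + 1\<close>.

  The upper bound is the classical strategy: transfer the \<open>n\<close> smaller discs to the third peg, move
  disc \<open>n + 1\<close> once, and transfer the smaller discs on top of it. For the lower bound one cuts a
  path at the \<^emph>\<open>first\<close> and at the \<^emph>\<open>last\<close> move of disc \<open>n + 1\<close>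
  (lemma \<open>largest_disc_decomposition\<close>). At both moments the smaller discs are all on one peg. At
  the first it is not the starting peg \<open>i\<close>, at the last it is not the goal \<open>j\<close>. So before the first
  and after the last move a whole tower of \<open>n\<close> discs changes peg, which costs at least \<open>t n\<close> each
  time, and costs are nonnegative in between. It does not matter here whether disc \<open>n + 1\<close>
  moves more than once, because the minimal cost \<open>t n\<close> is the same for every pair of pegs.

  For \<open>\<alpha> n = J (n + 1)\<close> the recurrence is solved in closed form by means of
  \<open>J (n + 1) + J n = 2 ^ n\<close>, and the recurrence of order three is read off from the closed form.\<close>

section \<open>Paths and towers\<close>

lemma perfect_in_states: "i \<in> pegs \<Longrightarrow> perfect n i \<in> states n"
  by (auto simp: perfect_def states_def)

lemma perfect_Suc: "perfect (Suc n) i = (perfect n i)(Suc n := i)"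
  by (auto simp: perfect_def fun_eq_iff)

lemma states_0: "s \<in> states 0 \<Longrightarrow> s = perfect 0 i"
  by (auto simp: states_def perfect_def fun_eq_iff)

lemma restrict_in_states: "s \<in> states (Suc n) \<Longrightarrow> restrict s {1..n} \<in> states n"
  by (auto simp: states_def PiE_iff)

lemma extend_in_states: "s \<in> states n \<Longrightarrow> p \<in> pegs \<Longrightarrow> s(Suc n := p) \<in> states (Suc n)"
  by (auto simp: states_def PiE_iff extensional_def)

lemma restrict_perfect_Suc: "restrict (perfect (Suc n) i) {1..n} = perfect n i"
  by (auto simp: perfect_def fun_eq_iff)

lemma three_pegs:
  assumes "{i, j, k} = pegs"
  shows "i \<in> pegs" "j \<in> pegs" "k \<in> pegs" "i \<noteq> j" "i \<noteq> k" "j \<noteq> k"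
proof -
  have "card {i, j, k} = 3"
    using assms by (simp add: pegs_def)
  then show "i \<noteq> j" "i \<noteq> k" "j \<noteq> k"
    by (auto simp: card_insert_if split: if_splits)
qed (use assms in blast)+

lemma obtain_third_peg:
  assumes "i \<in> pegs" "j \<in> pegs" "i \<noteq> j"
  obtains k where "{i, j, k} = pegs"
proof
  show "{i, j, 3 - i - j} = pegs"
    using assms by (auto simp: pegs_def)
qed

lemma path_cost_trans:
  assumes "path_cost w n s s' c" "path_cost w n s' s'' d"
  shows "path_cost w n s s'' (c + d)"
  using assms
proof (induction rule: path_cost.induct)
  case (move s m i j k s' c)
  then have "path_cost w n s s'' (w (m - 1) k + (c + d))"
    by (blast intro: path_cost.move)
  then show ?case
    by (simp add: add.assoc)
qed simp

lemma path_cost_nonneg: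
  assumes "path_cost w n s s' c" and "\<And>m k. k \<in> pegs \<Longrightarrow> w m k \<ge> 0"
  shows "c \<ge> 0"
  using assms(1)
proof (induction rule: path_cost.induct)
  case (move s m i j k s' c)
  then show ?case
    using assms(2)[of k "m - 1"] three_pegs(3)[of i j k] by simp
qed simp

text \<open>A larger disc at the bottom of any peg never obstructs the smaller ones.\<close>

lemma path_cost_add_largest:
  assumes "path_cost w n s s' c" "p \<in> pegs"
  shows "path_cost w (Suc n) (s(Suc n := p)) (s'(Suc n := p)) c"
  using assms(1)
proof (induction rule: path_cost.induct)
  case (stay s)
  then show ?case
    using assms(2) by (blast intro: path_cost.stay extend_in_states)
next
  case (move s m i j k s' c)
  then have m: "m \<noteq> Suc n" and legal: "legal_move (Suc n) (s(Suc n := p)) m i j"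
    by (auto simp: legal_move_def)
  have "path_cost w (Suc n) ((s(Suc n := p))(m := j)) (s'(Suc n := p)) c"
    using move.IH unfolding fun_upd_twist[OF m] .
  then show ?case
    using extend_in_states[OF move.hyps(1) assms(2)] legal move.hyps(3)
    by (blast intro: path_cost.move)
qed

section \<open>Moves of the largest disc\<close>

text \<open>The largest disc can move only when its source and its target carry no other disc, so that
  all others are stacked on the third peg.\<close>

lemma largest_move_tower:
  assumes "s \<in> states (Suc n)" "legal_move (Suc n) s (Suc n) i j" "{i, j, k} = pegs"
  shows "restrict s {1..n} = perfect n k"
proof
  fix l
  show "restrict s {1..n} l = perfect n k l"
  proof (cases "l \<in> {1..n}")
    case True
    then have "s l \<in> {i, j, k}" "s l \<noteq> i" "s l \<noteq> j"
      using assms by (auto simp: legal_move_def states_def PiE_iff)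
    then have "s l = k"
      by blast
    with True show ?thesis
      by (simp add: perfect_def)
  next
    case False
    then show ?thesis
      unfolding perfect_def restrict_def by (simp only: if_False)
  qed
qed

text \<open>The peg \<open>p\<close> carries the smaller discs at the first move of the largest disc, \<open>q\<close> at the last
  one. Only the inequality \<open>c1 + a + c2 \<le> c\<close> is claimed, which allows the moves between these two to
  be dropped; the induction adds moves at the front and so replaces the first move whenever the
  largest disc moves again.\<close>

lemma largest_disc_decomposition:
  assumes path: "path_cost w (Suc n) s s' c"
    and nonneg: "\<And>m k. k \<in> pegs \<Longrightarrow> w m k \<ge> 0"
    and lower: "\<And>k. k \<in> pegs \<Longrightarrow> a \<le> w n k"
  shows "s (Suc n) = s' (Suc n) \<and> path_cost w n (restrict s {1..n}) (restrict s' {1..n}) c \<or>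
    (\<exists>p \<in> pegs - {s (Suc n)}. \<exists>q \<in> pegs - {s' (Suc n)}. \<exists>c1 c2.
      path_cost w n (restrict s {1..n}) (perfect n p) c1 \<and>
      path_cost w n (perfect n q) (restrict s' {1..n}) c2 \<and> c1 + a + c2 \<le> c)"
    (is "?unmoved s s' c \<or> ?moved s s' c")
  using path
proof (induction rule: path_cost.induct)
  case (stay s)
  then show ?case
    by (blast intro: path_cost.stay restrict_in_states)
next
  case (move s m i j k s' c)
  let ?s1 = "s(m := j)"
  note pegs = three_pegs[OF move.hyps(3)]
  have si: "s m = i"
    using move.hyps(2) by (simp add: legal_move_def)
  show ?case
  proof (cases "m = Suc n")
    case True
    have tower: "restrict s {1..n} = perfect n k"
      using largest_move_tower move.hyps True by blast
    have "restrict ?s1 {1..n} = restrict s {1..n}"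
      using True by (auto simp: fun_eq_iff)
    with tower have tower1: "restrict ?s1 {1..n} = perfect n k"
      by simp
    have k: "k \<in> pegs - {s (Suc n)}"
      using pegs si True by blast
    have first: "path_cost w n (restrict s {1..n}) (perfect n k) 0"
      using tower pegs(3) by (simp add: path_cost.stay perfect_in_states)
    have cost: "a \<le> w (m - 1) k"
      using lower[OF pegs(3)] True by simp
    from move.IH show ?thesis
    proof
      assume last: "?unmoved ?s1 s' c"
      then have "k \<in> pegs - {s' (Suc n)}"
        using True pegs by auto
      moreover have "path_cost w n (perfect n k) (restrict s' {1..n}) c"
        using last unfolding tower1 by blast
      moreover have "0 + a + c \<le> w (m - 1) k + c"
        using cost by simp
      ultimately show ?thesis
        using k first by blast
    next
      assume "?moved ?s1 s' c"
      then obtain p q c1 c2 where q: "q \<in> pegs - {s' (Suc n)}"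
        and c1: "path_cost w n (restrict ?s1 {1..n}) (perfect n p) c1"
        and c2: "path_cost w n (perfect n q) (restrict s' {1..n}) c2"
        and le: "c1 + a + c2 \<le> c"
        by blast
      have "0 \<le> c1" "0 \<le> w (m - 1) k"
        using path_cost_nonneg[OF c1 nonneg] nonneg pegs(3) by auto
      then have "0 + a + c2 \<le> w (m - 1) k + c"
        using le by simp
      then show ?thesis
        using k first q c2 by blast
    qed
  next
    case False
    then have legal: "legal_move n (restrict s {1..n}) m i j"
      using move.hyps(2) by (auto simp: legal_move_def)
    then have "restrict ?s1 {1..n} = (restrict s {1..n})(m := j)"
      by (auto simp: fun_eq_iff legal_move_def)
    then have prepend: "path_cost w n (restrict s {1..n}) r (w (m - 1) k + d)"
      if "path_cost w n (restrict ?s1 {1..n}) r d" for r d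
      using that path_cost.move[OF restrict_in_states legal] move.hyps by auto
    have same: "?s1 (Suc n) = s (Suc n)"
      using False by simp
    from move.IH show ?thesis
    proof
      assume "?unmoved ?s1 s' c"
      then show ?thesis
        unfolding same using prepend by blast
    next
      assume "?moved ?s1 s' c"
      then obtain p q c1 c2 where "p \<in> pegs - {s (Suc n)}" and q: "q \<in> pegs - {s' (Suc n)}"
        and c1: "path_cost w n (restrict ?s1 {1..n}) (perfect n p) c1"
        and c2: "path_cost w n (perfect n q) (restrict s' {1..n}) c2"
        and le: "c1 + a + c2 \<le> c"
        unfolding same by blast
      moreover have "(w (m - 1) k + c1) + a + c2 \<le> w (m - 1) k + c"
        using le by simp
      ultimately show ?thesis
        using prepend[OF c1] by blast
    qed
  qed
qed

section \<open>Minimal costs when a disc costs the same between all pegs\<close>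

lemma classical_strategy:
  assumes pegs: "{i, j, k} = pegs" and cost: "w n k = a"
    and first: "path_cost w n (perfect n i) (perfect n k) c"
    and last: "path_cost w n (perfect n k) (perfect n j) d"
  shows "path_cost w (Suc n) (perfect (Suc n) i) (perfect (Suc n) j) (c + (a + d))"
proof -
  note three = three_pegs[OF pegs]
  let ?s = "(perfect n k)(Suc n := i)"
  have legal: "legal_move (Suc n) ?s (Suc n) i j"
    using three by (auto simp: legal_move_def perfect_def)
  have s: "?s \<in> states (Suc n)"
    using three by (simp add: extend_in_states perfect_in_states)
  have "path_cost w (Suc n) (?s(Suc n := j)) (perfect (Suc n) j) d"
    using path_cost_add_largest[OF last three(2)] by (simp add: perfect_Suc)
  from path_cost.move[OF s legal pegs this]
  have "path_cost w (Suc n) ?s (perfect (Suc n) j) (a + d)"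
    using cost by simp
  moreover have "path_cost w (Suc n) (perfect (Suc n) i) ?s c"
    using path_cost_add_largest[OF first three(1)] by (simp add: perfect_Suc)
  ultimately show ?thesis
    by (rule path_cost_trans[rotated])
qed

text \<open>The induction needs the statement for all pairs of pegs at once, since the towers of smaller
  discs travel between pegs other than \<open>i\<close> and \<open>j\<close>.\<close>

lemma is_min_cost_uniform:
  assumes w: "\<And>m k. k \<in> pegs \<Longrightarrow> w m k = \<alpha> m"
    and nonneg: "\<And>m. \<alpha> m \<ge> 0"
    and t0: "t 0 = 0" and t_Suc: "\<And>m. t (Suc m) = 2 * t m + \<alpha> m"
    and "i \<in> pegs" "j \<in> pegs" "i \<noteq> j"
  shows "is_min_cost w n (perfect n i) (perfect n j) (t n)"
  using assms(5-)
proof (induction n arbitrary: i j)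
  case 0
  have "path_cost w 0 (perfect 0 i) (perfect 0 j) 0"
    using 0 path_cost.stay[of "perfect 0 i"] states_0 perfect_in_states by metis
  then show ?case
    using path_cost_nonneg[of w 0] w nonneg t0 by (auto simp: is_min_cost_def)
next
  case (Suc n)
  have min: "is_min_cost w n (perfect n p) (perfect n q) (t n)"
    if "p \<in> pegs" "q \<in> pegs" "p \<noteq> q" for p q
    using Suc.IH that by blast
  obtain k where ijk: "{i, j, k} = pegs"
    using obtain_third_peg Suc.prems by blast
  note three = three_pegs[OF ijk]
  have "path_cost w (Suc n) (perfect (Suc n) i) (perfect (Suc n) j) (t n + (\<alpha> n + t n))"
    using classical_strategy[OF ijk, of w n "\<alpha> n"] w[OF three(3)] min[of i k] min[of k j] three
    unfolding is_min_cost_def by metis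
  moreover have "t n + (\<alpha> n + t n) = t (Suc n)"
    by (simp add: t_Suc)
  moreover have "t (Suc n) \<le> c"
    if path: "path_cost w (Suc n) (perfect (Suc n) i) (perfect (Suc n) j) c" for c
  proof -
    have ends: "perfect (Suc n) i (Suc n) = i" "perfect (Suc n) j (Suc n) = j"
      by (simp_all add: perfect_def)
    obtain p q c1 c2 where pq: "p \<in> pegs" "p \<noteq> i" "q \<in> pegs" "q \<noteq> j"
      and c1: "path_cost w n (perfect n i) (perfect n p) c1"
      and c2: "path_cost w n (perfect n q) (perfect n j) c2"
      and le: "c1 + \<alpha> n + c2 \<le> c"
      using largest_disc_decomposition[OF path, of "\<alpha> n"] w nonneg Suc.prems(3)
      unfolding restrict_perfect_Suc ends by auto
    have "t n \<le> c1" "t n \<le> c2"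
      using min[of i p] min[of q j] c1 c2 pq Suc.prems unfolding is_min_cost_def by blast+
    with le show ?thesis
      by (simp add: t_Suc)
  qed
  ultimately show ?case
    by (simp add: is_min_cost_def)
qed

section \<open>Jacobsthal costs\<close>

lemma jacobsthal_add_Suc: "jacobsthal (Suc n) + jacobsthal n = 2 ^ n"
  by (induction n) auto

theorem proposition9:
  fixes w :: "nat \<Rightarrow> nat \<Rightarrow> real"
  assumes "\<And>n k. k \<in> pegs \<Longrightarrow> w n k = real (jacobsthal (n + 1))"
  shows "\<exists>t :: nat \<Rightarrow> real.
    (\<forall>n i j k. {i, j, k} = pegs \<longrightarrow> is_min_cost w n (perfect n i) (perfect n j) (t n)) \<and>
    (\<forall>n. t n = 1 / 3 * ((real n + 1) * 2 ^ n - real (jacobsthal (n + 1)))) \<and>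
    t 0 = 0 \<and> t 1 = 1 \<and> t 2 = 3 \<and>
    (\<forall>n. t (n + 3) = 3 * t (n + 2) - 4 * t n)"
proof -
  define t :: "nat \<Rightarrow> real"
    where "t n = 1 / 3 * ((real n + 1) * 2 ^ n - real (jacobsthal (n + 1)))" for n
  have t0: "t 0 = 0"
    by (simp add: t_def)
  have t_Suc: "t (Suc n) = 2 * t n + real (jacobsthal (n + 1))" for n
  proof -
    have "real (jacobsthal (Suc (Suc n))) + real (jacobsthal (Suc n)) = 2 ^ Suc n"
      using jacobsthal_add_Suc[of "Suc n"] by (metis of_nat_add of_nat_numeral of_nat_power)
    then have "real (jacobsthal (Suc (Suc n))) = 2 * 2 ^ n - real (jacobsthal (Suc n))"
      by simp
    then show ?thesis
      by (simp add: t_def algebra_simps del: jacobsthal.simps)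
  qed
  have min: "is_min_cost w n (perfect n i) (perfect n j) (t n)" if "{i, j, k} = pegs" for n i j k
    using is_min_cost_uniform[where t = t, OF assms _ t0 t_Suc] three_pegs[OF that] by simp
  have rec: "t (n + 3) = 3 * t (n + 2) - 4 * t n" for n
    by (simp add: t_def eval_nat_numeral algebra_simps)
  have "t 1 = 1" "t 2 = 3"
    by (simp_all add: t_def eval_nat_numeral)
  with t0 min rec show ?thesis
    using t_def by blast
qed

end
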